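(* Let $T_n=\frac{1}{n+1}\binom{3n+1}{n}$ for $n\ge 0$. For a prime $p\ge5$ and $j\ge1$ define $$A_j:=\begin{cases}(p^j-1)/6,&p^j\equiv1\pmod6,\\(p^j-5)/6,&p^j\equiv5\pmod6,\end{cases}\qquad B_j:=\begin{cases}(p^j-4)/3,&p^j\equiv1\pmod6,\\(p^j-2)/3,&p^j\equiv5\pmod6,\end{cases}$$ and $E_j(y):=\mathbf{1}_{A_j>0}\,y^{A_j}+y^{B_j}$. Then for every prime $p\ge5$ and every $m\ge1$, the zero-run enumerator $Z_{p,m}(y)$ of $T_n\bmod p$ on $0\le n<p^m$ is $$Z_{p,m}(y)=E_m(y)+\frac{p-1}{2}\sum_{j=1}^{m-1}\left(\frac{p+1}{2}\right)^{m-j-1}E_j(y).$$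
   Context: For a prime $p$ and $m\ge1$, the zero-run enumerator is $Z_{p,m}(y)=\sum_R y^{|R|}$, where the sum runs over all maximal (nonempty) zero runs $R$ in the finite word $T_0,T_1,\ldots,T_{p^m-1}\pmod p$ (i.e. maximal intervals of consecutive indices in $[0,p^m-1]$ on which $T_n\equiv0\pmod p$) and $|R|$ is the length of $R$; a zero run meeting the right endpoint $p^m-1$ is counted with its truncated length inside this interval. For a statement $P$, $\mathbf{1}_P=1$ if $P$ is true and $0$ otherwise. Empty sums are $0$. *)

theory Defs
  imports "HOL-Computational_Algebra.Computational_Algebra" "HOL-Number_Theory.Cong"
begin

text \<open>The division in \<open>T\<close> is exact, see \<open>Suc_mult_T\<close> below.\<close>

definition T :: "nat \<Rightarrow> nat" where
  "T n = ((3 * n + 1) choose n) div (n + 1)"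

lemma Suc_dvd_binomial: "(n + 1) dvd ((3 * n + 1) choose n)"
proof -
  have "Suc n * ((3 * n + 1) choose Suc n) = (2 * n + 1) * ((3 * n + 1) choose n)"
    using binomial_absorb_comp[of "3 * n + 1" n] binomial_absorption[of n "3 * n + 1"]
    by (simp add: algebra_simps)
  then have "(n + 1) dvd (2 * n + 1) * ((3 * n + 1) choose n)"
    by (metis Suc_eq_plus1 dvd_triv_left)
  moreover have "coprime (n + 1) (2 * n + 1)"
  proof (rule coprimeI)
    fix d assume "d dvd n + 1" "d dvd 2 * n + 1"
    then have "d dvd 2 * (n + 1) - (2 * n + 1)"
      by (meson dvd_diff_nat dvd_mult)
    then show "is_unit d" by simp
  qed
  ultimately show ?thesis
    using coprime_dvd_mult_right_iff by blast
qed

lemma Suc_mult_T: "(n + 1) * T n = (3 * n + 1) choose n"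
  unfolding T_def using Suc_dvd_binomial by (rule dvd_mult_div_cancel)

definition zero_interval :: "nat \<Rightarrow> nat \<Rightarrow> nat set \<Rightarrow> bool" where
  "zero_interval p m R \<longleftrightarrow>
     (\<exists>a b. a \<le> b \<and> b < p ^ m \<and> R = {a..b}) \<and> (\<forall>n\<in>R. [T n = 0] (mod p))"

definition zero_runs :: "nat \<Rightarrow> nat \<Rightarrow> nat set set" where
  "zero_runs p m = {R. zero_interval p m R \<and> \<not> (\<exists>R'. zero_interval p m R' \<and> R \<subset> R')}"

lemma finite_zero_runs: "finite (zero_runs p m)"
  by (rule finite_subset[of _ "Pow {..<p ^ m}"]) (auto simp: zero_runs_def zero_interval_def)

text \<open>Enumerators are polynomials in the formal variable \<open>y\<close>, with \<open>y ^ k\<close> rendered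
  as \<open>monom 1 k\<close>.\<close>

definition Z :: "nat \<Rightarrow> nat \<Rightarrow> int poly" where
  "Z p m = (\<Sum>R\<in>zero_runs p m. monom 1 (card R))"

text \<open>For a prime \<open>p \<ge> 5\<close> and \<open>j \<ge> 1\<close>, the power \<open>p ^ j\<close> is congruent to 1 or 5 modulo 6, so
  the \<open>else\<close> branches are exactly the case of residue 5, and all divisions and natural-number
  subtractions below are exact.\<close>

definition A :: "nat \<Rightarrow> nat \<Rightarrow> nat" where
  "A p j = (if [p ^ j = 1] (mod 6) then (p ^ j - 1) div 6 else (p ^ j - 5) div 6)"

definition B :: "nat \<Rightarrow> nat \<Rightarrow> nat" where
  "B p j = (if [p ^ j = 1] (mod 6) then (p ^ j - 4) div 3 else (p ^ j - 2) div 3)"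

definition E :: "nat \<Rightarrow> nat \<Rightarrow> int poly" where
  "E p j = (if A p j > 0 then monom 1 (A p j) else 0) + monom 1 (B p j)"

end

theory Submission
  imports Defs
begin

text \<open>Since \<open>T n = (3n + 1)! / ((n + 1)! (2n + 1)!)\<close>, Legendre's formula shows that \<open>p\<close> divides
  \<open>T n\<close> iff for some \<open>q = p ^ j\<close> with \<open>j \<ge> 1\<close> the residue of \<open>n\<close> modulo \<open>q\<close> lies in one of the
  intervals \<open>[(q - 1) / 3, q / 2 - 1)\<close> and \<open>[(2q - 1) / 3, q - 1)\<close>, which contain \<open>A\<close> and \<open>B\<close>
  integers. For \<open>q = p ^ m\<close> these two intervals are runs, because the indices adjacent to them are
  nonzeros at every level; outside them the zero pattern is periodic with period \<open>Q = p ^ (m - 1)\<close>.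
  Count runs by a weight at their left endpoint. The complement of the two intervals then consists
  of \<open>(p - 1) / 2\<close> full periods together with initial pieces of lengths about \<open>Q / 3\<close> and
  \<open>2Q / 3\<close> minus one of length about \<open>Q / 2\<close>, and these pieces account for the runs at level
  \<open>m - 1\<close> except the two top ones. Hence \<open>Z p m = (p + 1) / 2 * Z p (m - 1) + E p m - E p (m - 1)\<close> for \<open>m \<ge> 2\<close>.\<close>

lemma smult_sum_right: "smult c (\<Sum>i\<in>S. f i) = (\<Sum>i\<in>S. smult c (f i))"
  by (induction S rule: infinite_finite_induct) (simp_all add: smult_add_right)

section \<open>Legendre's formula and the carries of \<open>T n\<close>\<close>

text \<open>Legendre's formula, by induction: passing from \<open>n\<close> to \<open>Suc n\<close>
  raises \<open>n div p ^ k\<close> exactly when \<open>p ^ k\<close> divides \<open>Suc n\<close>,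
  and the multiplicity of \<open>p\<close> in \<open>Suc n\<close> counts these \<open>k\<close>.
  The bound on \<open>n\<close> keeps all of them within \<open>1..K\<close>.\<close>

lemma multiplicity_fact_eq_sum:
  fixes p :: nat
  assumes "prime p" "n < p ^ Suc K"
  shows "multiplicity p (fact n) = (\<Sum>k = 1..K. n div p ^ k)"
  using assms(2)
proof (induction n)
  case 0
  then show ?case by simp
next
  case (Suc n)
  have p: "\<not> is_unit p" "p > 1" using assms(1) by (auto dest: prime_gt_1_nat)
  have *: "multiplicity p (Suc n) = card {k \<in> {1..K}. p ^ k dvd Suc n}"
  proof -
    have "multiplicity p (Suc n) \<le> K"
    proof (rule ccontr)
      assume "\<not> ?thesis"
      then have "p ^ Suc K dvd Suc n"
        by (metis Suc_leI multiplicity_dvd' not_le)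
      with Suc.prems show False by (auto dest: dvd_imp_le)
    qed
    then have "{k \<in> {1..K}. p ^ k dvd Suc n} = {1..multiplicity p (Suc n)}"
      using p by (auto simp: power_dvd_iff_le_multiplicity)
    then show ?thesis by simp
  qed
  have "multiplicity p (fact (Suc n)) = multiplicity p (Suc n) + multiplicity p (fact n :: nat)"
    using assms(1) unfolding fact_Suc of_nat_id
    by (subst prime_elem_multiplicity_mult_distrib) auto
  also have "\<dots> = (\<Sum>k = 1..K. of_bool (p ^ k dvd Suc n)) + (\<Sum>k = 1..K. n div p ^ k)"
    using Suc * by (simp add: sum.If_cases Int_def)
  also have "\<dots> = (\<Sum>k = 1..K. Suc n div p ^ k)"
    unfolding sum.distrib[symmetric] by (intro sum.cong) (auto simp: div_Suc dvd_eq_mod_eq_0)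
  finally show ?case .
qed

text \<open>\<open>carry q n\<close> says that the summand for \<open>q\<close> in Legendre's formula for \<open>T n\<close> is 1, not 0.\<close>

definition carry :: "nat \<Rightarrow> nat \<Rightarrow> bool" where
  "carry q n \<longleftrightarrow> (q \<le> 3 * (n mod q) + 1 \<and> 2 * (n mod q) + 1 < q) \<or>
     (2 * q \<le> 3 * (n mod q) + 1 \<and> n mod q + 1 < q)"

text \<open>With \<open>n = k * q + r\<close> the multiples of \<open>q\<close> cancel, as
  \<open>3 * k = k + 2 * k\<close>. The three quotients left over are sums of threshold indicators
  in \<open>r\<close>, and \<open>carry\<close> is their difference.\<close>

lemma div_eq_add_carry:
  fixes n q :: nat
  assumes "odd q" "q > 1"
  shows "(3 * n + 1) div q = (n + 1) div q + (2 * n + 1) div q + of_bool (carry q n)"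
proof -
  define k r where "k = n div q" and "r = n mod q"
  have n: "n = k * q + r" and r: "r < q" using assms by (auto simp: k_def r_def)
  have "(3 * n + 1) div q = 3 * k + (3 * r + 1) div q"
    using div_mult_self1[of q "3 * r + 1" "3 * k"] assms by (simp add: n algebra_simps)
  moreover have "(n + 1) div q = k + (r + 1) div q"
    using div_mult_self1[of q "r + 1" "k"] assms by (simp add: n algebra_simps)
  moreover have "(2 * n + 1) div q = 2 * k + (2 * r + 1) div q"
    using div_mult_self1[of q "2 * r + 1" "2 * k"] assms by (simp add: n algebra_simps)
  moreover have "(r + 1) div q = of_bool (r + 1 = q)"
    using r by auto
  moreover have "(2 * r + 1) div q = of_bool (q \<le> 2 * r + 1)"
    using r by (auto intro!: div_nat_eqI)
  moreover have "(3 * r + 1) div q = of_bool (q \<le> 3 * r + 1) + of_bool (2 * q \<le> 3 * r + 1)"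
    using r by (auto intro!: div_nat_eqI)
  moreover have "q \<noteq> 2 * r + 2" using assms by auto
  ultimately show ?thesis
    using r assms unfolding carry_def r_def[symmetric] by (auto simp: of_bool_def)
qed

lemma not_carry_less: "\<not> carry q n" if "3 * n + 1 < q"
proof -
  have "n mod q = n" using that by auto
  then show ?thesis using that by (auto simp: carry_def)
qed

lemma fact_eq_T_mult: "fact (3 * n + 1) = T n * fact (n + 1) * fact (2 * n + 1)"
proof -
  have "fact n * fact (2 * n + 1) * ((3 * n + 1) choose n) = (fact (3 * n + 1) :: nat)"
    using binomial_fact_lemma[of n "3 * n + 1"] by simp
  moreover have "fact (n + 1) = (n + 1) * (fact n :: nat)"
    by simp
  ultimately show ?thesis
    unfolding Suc_mult_T[symmetric] by (metis mult.assoc mult.commute)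
qed

section \<open>Runs of a predicate and their weights\<close>

definition zero_at :: "nat \<Rightarrow> nat \<Rightarrow> bool" where
  "zero_at p n \<longleftrightarrow> [T n = 0] (mod p)"

text \<open>No truncation at \<open>p ^ m\<close> is built in. The value is meaningful only if
  \<open>P\<close> fails somewhere from \<open>n\<close> on; for \<open>zero_at p\<close> the
  indices \<open>p ^ m - 1\<close> ensure this.\<close>

definition run_length :: "(nat \<Rightarrow> bool) \<Rightarrow> nat \<Rightarrow> nat" where
  "run_length P n = (LEAST k. \<not> P (n + k))"

definition run_start :: "(nat \<Rightarrow> bool) \<Rightarrow> nat \<Rightarrow> bool" where
  "run_start P n \<longleftrightarrow> P n \<and> (n = 0 \<or> \<not> P (n - 1))"

text \<open>Charging a whole run to its left endpoint turns the enumerator into a sum over indices,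
  which can be cut at arbitrary places.\<close>

definition run_weight :: "(nat \<Rightarrow> bool) \<Rightarrow> nat \<Rightarrow> int poly" where
  "run_weight P n = (if run_start P n then monom 1 (run_length P n) else 0)"

lemma run_length_eqI:
  assumes "\<And>i. i < k \<Longrightarrow> P (n + i)" "\<not> P (n + k)"
  shows "run_length P n = k"
  unfolding run_length_def using assms by (intro Least_equality) (auto simp: not_less[symmetric])

text \<open>Only \<open>a\<close> can start a run here, since every later index has a predecessor in
  the same run. The empty case is needed when \<open>A\<close> vanishes.\<close>

lemma sum_run_weight_interval:
  assumes "0 < a" "\<not> P (a - 1)" "\<And>n. a \<le> n \<Longrightarrow> n < b \<Longrightarrow> P n" "\<not> P b"
  shows "(\<Sum>n = a..<b. run_weight P n) = (if a < b then monom 1 (b - a) else 0)"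
proof (cases "a < b")
  case True
  have "run_length P a = b - a"
    using assms True by (intro run_length_eqI) auto
  then have "run_weight P a = monom 1 (b - a)"
    using assms True by (simp add: run_weight_def run_start_def)
  moreover have "run_weight P n = 0" if "n \<in> {Suc a..<b}" for n
  proof -
    have "P (n - 1)" using that by (intro assms(3)) auto
    then show ?thesis using that by (auto simp: run_weight_def run_start_def)
  qed
  ultimately show ?thesis using True by (simp add: sum.atLeast_Suc_lessThan)
qed simp

section \<open>Periodic sums and residues modulo 6\<close>

lemma sum_mod_periodic:
  fixes f :: "nat \<Rightarrow> 'a :: comm_semiring_1"
  assumes "r \<le> q"
  shows "(\<Sum>n<k * q + r. f (n mod q)) = of_nat k * (\<Sum>n<q. f n) + (\<Sum>n<r. f n)"
proof -
  have *: "(\<Sum>n<s. f ((j * q + n) mod q)) = (\<Sum>n<s. f n)" if "s \<le> q" for j s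
    using that by (intro sum.cong) auto
  have split: "(\<Sum>n<j * q + s. f (n mod q)) = (\<Sum>n<j * q. f (n mod q)) + (\<Sum>n<s. f n)"
    if "s \<le> q" for j s
    using *[OF that, of j] sum.nat_group[of f]
      sum.atLeastLessThan_concat[of 0 "j * q" "j * q + s" "\<lambda>n. f (n mod q)"]
      sum.shift_bounds_nat_ivl[of "\<lambda>n. f (n mod q)" 0 "j * q" s]
    by (simp add: lessThan_atLeast0 add.commute)
  have "(\<Sum>n<k * q. f (n mod q)) = of_nat k * (\<Sum>n<q. f n)"
  proof (induction k)
    case (Suc k)
    have "(\<Sum>n<Suc k * q. f (n mod q)) = (\<Sum>n<k * q + q. f (n mod q))"
      by (simp add: add.commute)
    then show ?case using Suc split[of q k] by (simp add: algebra_simps)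
  qed simp
  with split[OF assms] show ?thesis by simp
qed

lemma residue_mod_6_cases:
  fixes q :: nat
  assumes "odd q" "\<not> 3 dvd q"
  obtains t where "q = 6 * t + 1" | t where "q = 6 * t + 5"
proof -
  define r where "r = q mod 6"
  have r: "r < 6" and q: "q = 6 * (q div 6) + r" by (simp_all add: r_def)
  have "r mod 2 = q mod 2" "r mod 3 = q mod 3" by (simp_all add: r_def mod_mod_cancel)
  then have "r mod 2 = 1" "r mod 3 \<noteq> 0"
    using assms by (simp_all add: odd_iff_mod_2_eq_one dvd_eq_mod_eq_0)
  moreover have "r = 0 \<or> r = 1 \<or> r = 2 \<or> r = 3 \<or> r = 4 \<or> r = 5" using r by arith
  ultimately consider "r = 1" | "r = 5" by (elim disjE) simp_all
  then show thesis using q that by cases metis+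
qed

section \<open>Zeros of \<open>T n\<close> in terms of carries at powers of \<open>p\<close>\<close>

locale prime_ge_5 =
  fixes p :: nat
  assumes prime: "prime p" and ge_5: "p \<ge> 5"
begin

lemma p_odd: "odd p"
  using prime ge_5 prime_odd_nat[of p] by auto

lemma power_odd: "odd (p ^ j)"
  using p_odd by simp

lemma power_ge_5: "p ^ j \<ge> 5" if "j \<ge> 1"
  using power_increasing[of 1 j p] that ge_5 by simp

text \<open>For \<open>q = p ^ m\<close> the first two quotients are the ceilings of
  \<open>(q - 1) / 3\<close> and \<open>(2 * q - 1) / 3\<close>, the left ends of the carry
  intervals; \<open>q div 2\<close> is the right end of the first. Written in \<open>t\<close>, they
  are accessible to linear arithmetic.\<close>

lemma power_cases:
  obtains t where "p ^ m = 6 * t + 1" "(p ^ m + 1) div 3 = 2 * t"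
      "(2 * p ^ m + 1) div 3 = 4 * t + 1" "p ^ m div 2 = 3 * t"
  | t where "p ^ m = 6 * t + 5" "(p ^ m + 1) div 3 = 2 * t + 2"
      "(2 * p ^ m + 1) div 3 = 4 * t + 3" "p ^ m div 2 = 3 * t + 2"
proof -
  have "\<not> 3 dvd p ^ m"
    using prime ge_5 prime_dvd_power[of 3 p m] primes_dvd_imp_eq[of 3 p] by auto
  with power_odd[of m] show thesis
  proof (cases rule: residue_mod_6_cases)
    case (1 t)
    moreover have "(6 * t + 1 + 1) div 3 = 2 * t" "(2 * (6 * t + 1) + 1) div 3 = 4 * t + 1"
      "(6 * t + 1) div 2 = 3 * t"
      by (auto intro!: div_nat_eqI)
    ultimately show thesis using that(1)[of t] by simp
  next
    case (2 t)
    moreover have "(6 * t + 5 + 1) div 3 = 2 * t + 2" "(2 * (6 * t + 5) + 1) div 3 = 4 * t + 3"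
      "(6 * t + 5) div 2 = 3 * t + 2"
      by (auto intro!: div_nat_eqI)
    ultimately show thesis using that(2)[of t] by simp
  qed
qed

lemma zero_at_iff_carry: "zero_at p n \<longleftrightarrow> (\<exists>j\<ge>1. carry (p ^ j) n)"
proof -
  \<comment> \<open>A crude cutoff: \<open>j < p ^ j\<close> puts every power beyond
    \<open>K\<close> above \<open>3 * n + 1\<close>, so it has neither a Legendre term nor a
    carry.\<close>
  define K where "K = 3 * n + 1"
  have less: "3 * n + 1 < p ^ j" if "j > K" for j
    using that power_gt_expt[of p j] ge_5 unfolding K_def by simp
  have T_pos: "T n > 0"
    using Suc_mult_T[of n] zero_less_binomial[of n "3 * n + 1"] by (intro gr0I) simp
  have v: "multiplicity p (fact k) = (\<Sum>j = 1..K. k div p ^ j)" if "k \<le> 3 * n + 1" for k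
    using multiplicity_fact_eq_sum[OF prime, of k K] less[of "Suc K"] that by simp
  have "multiplicity p (fact (3 * n + 1)) =
      multiplicity p (T n) + multiplicity p (fact (n + 1)) + multiplicity p (fact (2 * n + 1))"
    unfolding fact_eq_T_mult using T_pos prime
    by (simp add: prime_elem_multiplicity_mult_distrib del: fact_Suc Suc_eq_plus1)
  moreover have "multiplicity p (fact (3 * n + 1)) = multiplicity p (fact (n + 1)) +
      multiplicity p (fact (2 * n + 1)) + (\<Sum>j = 1..K. of_bool (carry (p ^ j) n))"
  proof -
    have "(3 * n + 1) div p ^ j =
        (n + 1) div p ^ j + (2 * n + 1) div p ^ j + of_bool (carry (p ^ j) n)"
      if "j \<in> {1..K}" for j
      using that power_ge_5[of j] power_odd[of j] by (intro div_eq_add_carry) auto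
    then show ?thesis
      using v[of "3 * n + 1"] v[of "n + 1"] v[of "2 * n + 1"] by (simp add: sum.distrib del: fact_Suc)
  qed
  ultimately have "multiplicity p (T n) = (\<Sum>j = 1..K. of_bool (carry (p ^ j) n))"
    by simp
  moreover have "zero_at p n \<longleftrightarrow> multiplicity p (T n) > 0"
    using prime T_pos by (auto simp: zero_at_def cong_0_iff prime_multiplicity_gt_zero_iff)
  ultimately have "zero_at p n \<longleftrightarrow> (\<exists>j\<in>{1..K}. carry (p ^ j) n)"
    by (auto simp: sum_eq_0_iff simp flip: neq0_conv)
  also have "\<dots> \<longleftrightarrow> (\<exists>j\<ge>1. carry (p ^ j) n)"
    using less not_carry_less by (meson atLeastAtMost_iff not_le)
  finally show ?thesis .
qed

lemma not_carry_of_less_power: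
  assumes "n < p ^ m" "m < j"
  shows "\<not> carry (p ^ j) n"
proof (rule not_carry_less)
  have "5 * p ^ m \<le> p * p ^ m" using ge_5 by simp
  also have "\<dots> \<le> p ^ j" using power_increasing[of "Suc m" j p] assms ge_5 by simp
  finally show "3 * n + 1 < p ^ j" using assms by simp
qed

lemma zero_at_iff_carry_le:
  assumes "n < p ^ m"
  shows "zero_at p n \<longleftrightarrow> (\<exists>j\<in>{1..m}. carry (p ^ j) n)"
  unfolding zero_at_iff_carry
  by (meson assms atLeastAtMost_iff not_carry_of_less_power not_le)

lemma carry_mod_power:
  assumes "j \<le> m"
  shows "carry (p ^ j) (n mod p ^ m) \<longleftrightarrow> carry (p ^ j) n"
  using assms by (simp add: carry_def mod_mod_cancel le_imp_power_dvd)

text \<open>Carries at levels up to \<open>m\<close> depend only on \<open>n mod p ^ m\<close>, and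
  the one remaining level is excluded by hypothesis. This is the source of the periodicity.\<close>

lemma zero_at_mod_power:
  assumes "n < p ^ Suc m" "\<not> carry (p ^ Suc m) n"
  shows "zero_at p (n mod p ^ m) \<longleftrightarrow> zero_at p n"
proof -
  have "n mod p ^ m < p ^ m" using ge_5 by simp
  moreover have "{1..Suc m} = insert (Suc m) {1..m}" by auto
  ultimately show ?thesis
    using zero_at_iff_carry_le[OF assms(1)] zero_at_iff_carry_le[of "n mod p ^ m" m] assms(2)
    by (auto simp: carry_mod_power)
qed

section \<open>Nonzero indices bordering the top intervals\<close>

text \<open>The divisibility passes to every lower power \<open>p ^ j\<close> and to the residue of
  \<open>n\<close> there, so all levels are settled by one check at a generic odd modulus.\<close>

lemma not_zero_atI:
  assumes "n < p ^ m" "p ^ m dvd a * n + b"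
    and "\<And>q r. odd q \<Longrightarrow> q \<ge> 5 \<Longrightarrow> r < q \<Longrightarrow> q dvd a * r + b \<Longrightarrow> \<not> carry q r"
  shows "\<not> zero_at p n"
proof -
  have "\<not> carry (p ^ j) n" if j: "j \<in> {1..m}" for j
  proof -
    let ?q = "p ^ j"
    have "?q dvd a * n + b" using j by (intro dvd_trans[OF le_imp_power_dvd assms(2)]) auto
    moreover have "(a * (n mod ?q) + b) mod ?q = (a * n + b) mod ?q"
      by (intro mod_add_cong mod_mult_cong) simp_all
    ultimately have "?q dvd a * (n mod ?q) + b"
      by (simp add: dvd_eq_mod_eq_0)
    then have "\<not> carry ?q (n mod ?q)"
      using j power_odd[of j] power_ge_5[of j] ge_5 by (intro assms(3)) auto
    then show ?thesis by (simp add: carry_mod_power)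
  qed
  then show ?thesis using zero_at_iff_carry_le[OF assms(1)] by blast
qed

lemma not_zero_at_0: "\<not> zero_at p 0"
  by (simp add: zero_at_iff_carry carry_def)

text \<open>At every level the residue is \<open>q - 1\<close>, just past the second carry interval.
  Consequently no run is truncated at the right endpoint.\<close>

lemma not_zero_at_last: "\<not> zero_at p (p ^ m - 1)"
proof (rule not_zero_atI[of _ m 1 1])
  show "\<not> carry q r" if "odd q" "q \<ge> 5" "r < q" "q dvd 1 * r + 1" for q r
    using that by (auto simp: carry_def dest: dvd_imp_le)
qed (use ge_5 in auto)

lemma not_zero_at_mid: "\<not> zero_at p (p ^ m div 2)"
proof (rule not_zero_atI[of _ m 2 1])
  show "\<not> carry q r" if "odd q" "q \<ge> 5" "r < q" "q dvd 2 * r + 1" for q r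
  proof -
    from that(4) obtain k where k: "2 * r + 1 = q * k" by (rule dvdE)
    have "q * k < q * 2" using k that by linarith
    then have "k < 2" by simp
    then have "k = 1" using k by (cases k) auto
    then show ?thesis using k that by (auto simp: carry_def)
  qed
qed (use ge_5 power_odd[of m] in \<open>auto simp: odd_two_times_div_two_succ\<close>)

text \<open>Size and \<open>3\<close> not dividing \<open>b\<close> force \<open>3 * r + b\<close>
  to be \<open>q\<close> or \<open>2 * q\<close>, so \<open>3 * r + 1\<close> falls just short of
  that multiple and \<open>r\<close> lies just left of a carry interval. For \<open>2 * q\<close>
  the residue is also beyond the first interval, because \<open>q \<ge> 5\<close>.\<close>

lemma not_zero_at_if_dvd_3:
  assumes "n < p ^ m" "p ^ m dvd 3 * n + b" "b = 2 \<or> b = 4"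
  shows "\<not> zero_at p n"
proof (rule not_zero_atI[OF assms(1,2)])
  show "\<not> carry q r" if "odd q" "q \<ge> 5" "r < q" "q dvd 3 * r + b" for q r
  proof -
    from that(4) obtain k where k: "3 * r + b = q * k" by (rule dvdE)
    have "3 * r + b < q * 4" using that assms(3) by auto
    then have "k < 4" unfolding k by simp
    show ?thesis
    proof (cases "k = 3")
      case True
      then have "3 * r + b = 3 * q" using k by simp
      then have "3 dvd b" by (metis dvd_add_right_iff dvd_triv_left)
      then show ?thesis using assms(3) by auto
    next
      case False
      with \<open>k < 4\<close> have "k = 0 \<or> k = 1 \<or> k = 2" by arith
      then show ?thesis using k that assms(3) by (auto simp: carry_def)
    qed
  qed
qed

lemma not_zero_at_third:
  assumes "m \<ge> 1"
  shows "\<not> zero_at p ((p ^ m + 1) div 3 - 1)" "\<not> zero_at p ((2 * p ^ m + 1) div 3 - 1)"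
proof -
  define q where "q = p ^ m"
  have q: "q \<ge> 5" using power_ge_5[OF assms] by (simp add: q_def)
  \<comment> \<open>The shift is 4 for \<open>q\<close> congruent to 1 modulo 6 and 2 for residue 5;
    for the second interval the two shifts trade places.\<close>
  have "3 * ((q + 1) div 3 - 1) + 2 = q \<or> 3 * ((q + 1) div 3 - 1) + 4 = q"
    using power_cases[of m] q unfolding q_def[symmetric] by cases auto
  moreover have "(q + 1) div 3 - 1 < q" using q by linarith
  ultimately show "\<not> zero_at p ((p ^ m + 1) div 3 - 1)"
    using not_zero_at_if_dvd_3[of "(q + 1) div 3 - 1" m 2]
      not_zero_at_if_dvd_3[of "(q + 1) div 3 - 1" m 4] unfolding q_def by auto
  have "3 * ((2 * q + 1) div 3 - 1) + 2 = 2 * q \<or> 3 * ((2 * q + 1) div 3 - 1) + 4 = 2 * q"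
    using power_cases[of m] q unfolding q_def[symmetric] by cases auto
  moreover have "(2 * q + 1) div 3 - 1 < q" using q by linarith
  ultimately show "\<not> zero_at p ((2 * p ^ m + 1) div 3 - 1)"
    using not_zero_at_if_dvd_3[of "(2 * q + 1) div 3 - 1" m 2]
      not_zero_at_if_dvd_3[of "(2 * q + 1) div 3 - 1" m 4] unfolding q_def by auto
qed

lemma carry_top_iff:
  assumes "n < p ^ m"
  shows "carry (p ^ m) n \<longleftrightarrow>
    n \<in> {(p ^ m + 1) div 3..<p ^ m div 2} \<union> {(2 * p ^ m + 1) div 3..<p ^ m - 1}"
proof -
  have "p ^ m \<le> 3 * n + 1 \<longleftrightarrow> (p ^ m + 1) div 3 \<le> n" "2 * n + 1 < p ^ m \<longleftrightarrow> n < p ^ m div 2"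
    "2 * p ^ m \<le> 3 * n + 1 \<longleftrightarrow> (2 * p ^ m + 1) div 3 \<le> n"
    using power_cases[of m] by (cases; auto)+
  then show ?thesis using assms by (auto simp: carry_def)
qed

section \<open>The enumerator as a sum of weights\<close>

abbreviation w :: "nat \<Rightarrow> int poly" where
  "w \<equiv> run_weight (zero_at p)"

text \<open>Maximal zero intervals correspond bijectively to run starts below \<open>p ^ m\<close>.
  The nonzero at \<open>p ^ m - 1\<close> stops every run inside the range, so the untruncated
  \<open>run_length\<close> is the cardinality.\<close>

lemma Z_eq_sum_run_weight: "Z p m = (\<Sum>n<p ^ m. w n)"
proof -
  let ?P = "zero_at p" and ?L = "run_length (zero_at p)"
  define S where "S = {n. n < p ^ m \<and> run_start ?P n}"
  have L: "?P (n + i)" if "i < ?L n" for n i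
    using that not_less_Least unfolding run_length_def by blast
  have ex: "\<exists>k. \<not> ?P (n + k) \<and> n + k < p ^ m" if "n < p ^ m" for n
    using not_zero_at_last[of m] that by (intro exI[of _ "p ^ m - 1 - n"]) auto
  have not_L: "\<not> ?P (n + ?L n)" if "n < p ^ m" for n
    unfolding run_length_def using ex[OF that] LeastI[of "\<lambda>k. \<not> ?P (n + k)"] by blast
  have L_le: "n + ?L n < p ^ m" if n: "n < p ^ m" for n
  proof -
    obtain k where "\<not> ?P (n + k)" "n + k < p ^ m" using ex[OF n] by blast
    then show ?thesis using Least_le[of "\<lambda>k. \<not> ?P (n + k)" k] by (simp add: run_length_def)
  qed
  have L_pos: "?L n > 0" if "n \<in> S" for n
    using that not_L[of n] by (intro gr0I) (auto simp: S_def run_start_def)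
  have zi: "zero_interval p m R \<longleftrightarrow> (\<exists>a b. a \<le> b \<and> b < p ^ m \<and> R = {a..b} \<and> (\<forall>n\<in>{a..b}. ?P n))"
    for R unfolding zero_interval_def zero_at_def by blast
  have "zero_runs p m = (\<lambda>n. {n..<n + ?L n}) ` S"
  proof (intro equalityI subsetI)
    fix R assume "R \<in> zero_runs p m"
    then have R: "zero_interval p m R"
      and max: "\<And>R'. zero_interval p m R' \<Longrightarrow> \<not> R \<subset> R'"
      by (auto simp: zero_runs_def)
    from R obtain a b where ab: "a \<le> b" "b < p ^ m" "R = {a..b}" "\<forall>n\<in>{a..b}. ?P n"
      unfolding zi by blast
    have start: "run_start ?P a"
    proof (rule ccontr)
      assume "\<not> ?thesis"
      then have a: "a > 0" "?P (a - 1)" using ab by (auto simp: run_start_def)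
      have "zero_interval p m {a - 1..b}" unfolding zi
      proof (intro exI conjI ballI)
        fix n assume "n \<in> {a - 1..b}"
        then show "?P n" using a ab by (cases "n = a - 1") auto
      qed (use ab in auto)
      moreover have "R \<subset> {a - 1..b}" using a ab by (auto simp: psubset_eq)
      ultimately show False using max by blast
    qed
    have "Suc b < p ^ m" using ab not_zero_at_last[of m]
      by (metis Suc_diff_1 Suc_lessI atLeastAtMost_iff diff_Suc_1 order_refl)
    have "\<not> ?P (Suc b)"
    proof
      assume "?P (Suc b)"
      then have "zero_interval p m {a..Suc b}"
        unfolding zi using ab \<open>Suc b < p ^ m\<close>
        by (intro exI[of _ a] exI[of _ "Suc b"]) (auto simp: atLeastAtMostSuc_conv)
      moreover have "R \<subset> {a..Suc b}" using ab by (auto simp: psubset_eq)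
      ultimately show False using max by blast
    qed
    then have "?L a = Suc b - a" using ab by (intro run_length_eqI) auto
    then have "R = {a..<a + ?L a}" using ab by auto
    moreover have "a \<in> S" using start ab by (auto simp: S_def)
    ultimately show "R \<in> (\<lambda>n. {n..<n + ?L n}) ` S" by blast
  next
    fix R assume "R \<in> (\<lambda>n. {n..<n + ?L n}) ` S"
    then obtain n where n: "n \<in> S" and R: "R = {n..<n + ?L n}" by blast
    have nm: "n < p ^ m" using n by (simp add: S_def)
    have R': "R = {n..n + ?L n - 1}" using R L_pos[OF n] by auto
    have PR: "?P k" if "k \<in> R" for k
      using that L[of "k - n" n] unfolding R by auto
    have "zero_interval p m R"
      unfolding zi using R' PR L_le[OF nm] L_pos[OF n]
      by (intro exI[of _ n] exI[of _ "n + ?L n - 1"]) auto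
    \<comment> \<open>A larger interval would contain \<open>n - 1\<close> or
      \<open>n + ?L n\<close>, both of which are nonzeros.\<close>
    moreover have False if R2: "zero_interval p m R2" "R \<subset> R2" for R2
    proof -
      obtain c d where cd: "c \<le> d" "R2 = {c..d}" "\<forall>k\<in>{c..d}. ?P k" using R2(1) unfolding zi by blast
      have "{n..n + ?L n - 1} \<subset> {c..d}" using R2(2) R' cd by simp
      then have le: "c \<le> n" "n + ?L n - 1 \<le> d" and ne: "\<not> (c = n \<and> n + ?L n - 1 = d)"
        using L_pos[OF n] by (auto simp: psubset_eq)
      have "c = n"
      proof (rule ccontr)
        assume "c \<noteq> n"
        then have "n > 0" "n - 1 \<in> {c..d}" using le L_pos[OF n] by auto
        then have "n > 0" "?P (n - 1)" using cd(3) by blast+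
        then show False using n by (auto simp: S_def run_start_def)
      qed
      then have "n + ?L n \<in> {c..d}" using ne le by auto
      then show False using not_L[OF nm] cd by blast
    qed
    ultimately show "R \<in> zero_runs p m" unfolding zero_runs_def by blast
  qed
  moreover have "inj_on (\<lambda>n. {n..<n + ?L n}) S"
    by (rule inj_onI) (metis L_pos atLeastLessThan_eq_iff less_add_same_cancel1)
  ultimately have "Z p m = (\<Sum>n\<in>S. monom 1 (?L n))"
    unfolding Z_def by (simp add: sum.reindex)
  also have "\<dots> = (\<Sum>n<p ^ m. w n)"
    unfolding run_weight_def by (simp add: sum.If_cases S_def lessThan_def Int_def)
  finally show ?thesis .
qed

text \<open>Both intervals consist of zeros by the carry at level \<open>m\<close> and are bordered
  by nonzeros, so each is at most one run, of length \<open>A p m\<close> or \<open>B p m\<close>.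
  If the first is empty it contributes 0, matching the indicator in \<open>E\<close>.\<close>

lemma E_eq:
  assumes "m \<ge> 1"
  shows "E p m = (\<Sum>n = (p ^ m + 1) div 3..<p ^ m div 2. w n) +
    (\<Sum>n = (2 * p ^ m + 1) div 3..<p ^ m - 1. w n)"
proof -
  define q where "q = p ^ m"
  have q: "q \<ge> 5" using power_ge_5[OF assms] by (simp add: q_def)
  have zero: "zero_at p n" if "n \<in> {(q + 1) div 3..<q div 2} \<union> {(2 * q + 1) div 3..<q - 1}" for n
    using that assms carry_top_iff[of n m] q unfolding zero_at_iff_carry q_def by fastforce
  have "(\<Sum>n = (q + 1) div 3..<q div 2. w n) =
      (if (q + 1) div 3 < q div 2 then monom 1 (q div 2 - (q + 1) div 3) else 0)"
    using not_zero_at_third[OF assms] not_zero_at_mid[of m] q zero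
    by (intro sum_run_weight_interval) (auto simp: q_def)
  moreover have "(\<Sum>n = (2 * q + 1) div 3..<q - 1. w n) =
      (if (2 * q + 1) div 3 < q - 1 then monom 1 (q - 1 - (2 * q + 1) div 3) else 0)"
    using not_zero_at_third[OF assms] not_zero_at_last[of m] q zero
    by (intro sum_run_weight_interval) (auto simp: q_def)
  moreover have "A p m = q div 2 - (q + 1) div 3" "B p m = q - 1 - (2 * q + 1) div 3"
    "(2 * q + 1) div 3 < q - 1"
    using power_cases[of m] q unfolding A_def B_def cong_def q_def[symmetric] by (cases; auto)+
  ultimately show ?thesis unfolding q_def E_def by simp
qed

lemma Z_eq_E_add:
  assumes "m \<ge> 1"
  shows "Z p m = E p m + (\<Sum>n<(p ^ m + 1) div 3. w n) +
    (\<Sum>n = p ^ m div 2..<(2 * p ^ m + 1) div 3. w n)"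
proof -
  define q where "q = p ^ m"
  have q: "q \<ge> 5" using power_ge_5[OF assms] by (simp add: q_def)
  have "w (q - 1) = 0"
    using not_zero_at_last[of m] by (simp add: run_weight_def run_start_def q_def)
  moreover have "{..<q} = {0..<Suc (q - 1)}" using q by auto
  ultimately have "(\<Sum>n<q. w n) = (\<Sum>n = 0..<q - 1. w n)" by simp
  moreover have "(q + 1) div 3 \<le> q div 2" "q div 2 \<le> (2 * q + 1) div 3" "(2 * q + 1) div 3 \<le> q - 1"
    using q by linarith+
  ultimately have "(\<Sum>n<q. w n) = (\<Sum>n = 0..<(q + 1) div 3. w n) +
      (\<Sum>n = (q + 1) div 3..<q div 2. w n) + (\<Sum>n = q div 2..<(2 * q + 1) div 3. w n) +
      (\<Sum>n = (2 * q + 1) div 3..<q - 1. w n)"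
    by (simp add: sum.atLeastLessThan_concat)
  then show ?thesis
    using E_eq[OF assms] Z_eq_sum_run_weight[of m]
    by (simp add: q_def lessThan_atLeast0 algebra_simps)
qed

section \<open>Periodicity and the recursion in \<open>m\<close>\<close>

text \<open>Periodicity of zeros gives periodicity of weights only if runs are not cut differently.
  Residues \<open>0\<close> and \<open>p ^ m - 1\<close> are nonzeros, so no run crosses a period
  boundary; \<open>a\<close> and \<open>b - 1\<close> are nonzeros, so none crosses the ends of the
  stretch.\<close>

lemma run_weight_mod_power:
  assumes safe: "\<And>x. a \<le> x \<Longrightarrow> x < b \<Longrightarrow> \<not> carry (p ^ Suc m) x"
    and b: "b \<le> p ^ Suc m" "\<not> zero_at p (b - 1)"
    and a: "\<not> zero_at p a" and n: "a \<le> n" "n < b"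
  shows "w n = w (n mod p ^ m)"
proof -
  let ?P = "zero_at p" and ?Q = "p ^ m"
  have P: "?P (x mod ?Q) \<longleftrightarrow> ?P x" if "a \<le> x" "x < b" for x
    using that b safe by (intro zero_at_mod_power) auto
  show ?thesis
  \<comment> \<open>Otherwise \<open>n\<close> and its residue are both nonzeros and both weights
    vanish. In the main case \<open>n - 1\<close> lies in the same stretch and the same
    period.\<close>
  proof (cases "?P n \<and> n > a \<and> n mod ?Q > 0")
    case False
    then consider "\<not> ?P n" | "n = a" | "n mod ?Q = 0" using n by linarith
    then have "\<not> ?P n \<and> \<not> ?P (n mod ?Q)"
      using P[OF n] a not_zero_at_0 by cases auto
    then show ?thesis by (simp add: run_weight_def run_start_def)
  next
    case True
    define r where "r = n mod ?Q"
    have shift: "(n + i) mod ?Q = r + i" if "r + i < ?Q" for i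
      using that unfolding r_def by (metis mod_add_left_eq mod_less)
    have r: "r > 0" "r < ?Q" using True ge_5 by (auto simp: r_def)
    have "(n - 1) mod ?Q = r - 1"
    proof -
      have "n - 1 = n div ?Q * ?Q + (r - 1)" using r by (simp add: r_def div_mult_mod_eq)
      then show ?thesis using mod_mult_self3[of "n div ?Q" ?Q "r - 1"] r by simp
    qed
    then have start: "run_start ?P r \<longleftrightarrow> run_start ?P n"
      using P[OF n] P[of "n - 1"] True r n unfolding r_def[symmetric] by (auto simp: run_start_def)
    define k where "k = run_length ?P r"
    have ex: "\<not> ?P (r + (?Q - 1 - r))" using r not_zero_at_last[of m] by simp
    have k: "\<not> ?P (r + k)" "k \<le> ?Q - 1 - r"
      unfolding k_def run_length_def using LeastI[of "\<lambda>k. \<not> ?P (r + k)", OF ex]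
      Least_le[of "\<lambda>k. \<not> ?P (r + k)", OF ex] by auto
    have Pk: "?P (r + i)" if "i < k" for i
      using that not_less_Least unfolding k_def run_length_def by blast
    have eq: "?P (n + i) \<longleftrightarrow> ?P (r + i)" if "i \<le> k" "n + i < b" for i
      using P[of "n + i"] shift[of i] that n k r by auto
    \<comment> \<open>If the copied run reached \<open>b\<close>, it would make \<open>b - 1\<close>
      a zero.\<close>
    have nk: "n + k < b"
    proof (rule ccontr)
      assume "\<not> ?thesis"
      then have "?P (n + (b - 1 - n))" using Pk[of "b - 1 - n"] eq[of "b - 1 - n"] n by auto
      then show False using b n by simp
    qed
    have "run_length ?P n = k"
      using eq nk Pk k by (intro run_length_eqI) auto
    then show ?thesis using start by (simp add: run_weight_def k_def r_def)
  qed
qed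

lemma Z_Suc:
  assumes "m \<ge> 1"
  shows "Z p (Suc m) = of_nat ((p + 1) div 2) * Z p m + E p (Suc m) - E p m"
proof -
  define Q q where "Q = p ^ m" and "q = p ^ Suc m"
  define H where "H = (\<lambda>x. \<Sum>n<x. w n)"
  define G where "G = (\<lambda>x. \<Sum>n<x. w (n mod Q))"
  have Q: "Q \<ge> 5" using power_ge_5[OF assms] by (simp add: Q_def)
  have q: "q \<ge> 5" using power_ge_5[of "Suc m"] by (simp add: q_def)
  have qQ: "q = p * Q" by (simp add: q_def Q_def)
  have ivl: "(\<Sum>n = a..<b. f n) = (\<Sum>n<b. f n) - (\<Sum>n<a. f n)" if "a \<le> b"
    for a b and f :: "nat \<Rightarrow> int poly"
    using sum.atLeastLessThan_concat[of 0 a b f] that by (simp add: lessThan_atLeast0 algebra_simps)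
  have order: "(q + 1) div 3 \<le> q div 2" "q div 2 \<le> (2 * q + 1) div 3" "(2 * q + 1) div 3 \<le> q"
    "Q div 2 \<le> (2 * Q + 1) div 3"
    using q Q by linarith+
  have "Z p m = E p m + H ((Q + 1) div 3) + H ((2 * Q + 1) div 3) - H (Q div 2)"
    using Z_eq_E_add[OF assms] unfolding Q_def[symmetric] ivl[OF order(4)] by (simp add: H_def)
  \<comment> \<open>Substituting this below replaces the incomplete periods by
    \<open>Z p m - E p m\<close>.\<close>
  then have Hm: "H (Q div 2) = E p m + H ((Q + 1) div 3) + H ((2 * Q + 1) div 3) - Z p m"
    by (simp add: algebra_simps)
  have "(\<Sum>n<(q + 1) div 3. w n) = G ((q + 1) div 3)"
  proof -
    have "w n = w (n mod Q)" if "n < (q + 1) div 3" for n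
      unfolding Q_def
    proof (rule run_weight_mod_power[of 0 "(q + 1) div 3"])
      show "\<not> carry (p ^ Suc m) x" if "x < (q + 1) div 3" for x
        using carry_top_iff[of x "Suc m"] that order unfolding q_def[symmetric] by auto
    qed (use that order not_zero_at_third[of "Suc m"] not_zero_at_0 in \<open>auto simp: q_def\<close>)
    then show ?thesis unfolding G_def by (intro sum.cong) auto
  qed
  moreover have "(\<Sum>n = q div 2..<(2 * q + 1) div 3. w n) = G ((2 * q + 1) div 3) - G (q div 2)"
  proof -
    have "w n = w (n mod Q)" if "q div 2 \<le> n" "n < (2 * q + 1) div 3" for n
      unfolding Q_def
    proof (rule run_weight_mod_power[of "q div 2" "(2 * q + 1) div 3"])
      show "\<not> carry (p ^ Suc m) x" if "q div 2 \<le> x" "x < (2 * q + 1) div 3" for x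
        using carry_top_iff[of x "Suc m"] that order unfolding q_def[symmetric] by auto
    qed (use that order not_zero_at_third[of "Suc m"] not_zero_at_mid[of "Suc m"] in
        \<open>auto simp: q_def\<close>)
    then have "(\<Sum>n = q div 2..<(2 * q + 1) div 3. w n) =
        (\<Sum>n = q div 2..<(2 * q + 1) div 3. w (n mod Q))"
      by (intro sum.cong) auto
    then show ?thesis unfolding G_def ivl[OF order(2)] .
  qed
  ultimately have Zq: "Z p (Suc m) =
      E p (Suc m) + G ((q + 1) div 3) + G ((2 * q + 1) div 3) - G (q div 2)"
    using Z_eq_E_add[of "Suc m"] by (simp add: q_def)
  have G: "G (k * Q + r) = of_nat k * Z p m + H r" if "r \<le> Q" for k r
    using sum_mod_periodic[OF that, of w k] Z_eq_sum_run_weight[of m]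
    by (simp add: G_def H_def Q_def)
  obtain t where p: "p = 6 * t + 1 \<or> p = 6 * t + 5"
    using power_cases[of 1] by (metis power_one_right)
  have le: "(Q + 1) div 3 \<le> Q" "(2 * Q + 1) div 3 \<le> Q" "Q div 2 \<le> Q" using Q by linarith+
  \<comment> \<open>Naming the product keeps the divisions below linear.\<close>
  define X where "X = t * Q"
  from p show ?thesis
  proof
    assume pt: "p = 6 * t + 1"
    \<comment> \<open>The full periods number \<open>2 * t + 4 * t - 3 * t = (p - 1) / 2\<close>;
      the incomplete ones supply one more \<open>Z p m\<close>, and \<open>- E p m\<close>.\<close>
    have qt: "q = 6 * X + Q" by (simp add: qQ pt X_def algebra_simps)
    have "(q + 1) div 3 = 2 * X + (Q + 1) div 3"
      "(2 * q + 1) div 3 = 4 * X + (2 * Q + 1) div 3" "q div 2 = 3 * X + Q div 2"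
      using div_mult_self4[of 3 "2 * X" "Q + 1"] div_mult_self4[of 3 "4 * X" "2 * Q + 1"]
        div_mult_self4[of 2 "3 * X" Q]
      by (simp_all add: qt)
    then have "(q + 1) div 3 = (2 * t) * Q + (Q + 1) div 3"
      "(2 * q + 1) div 3 = (4 * t) * Q + (2 * Q + 1) div 3"
      "q div 2 = (3 * t) * Q + Q div 2"
      by (simp_all add: X_def)
    then have "Z p (Suc m) = E p (Suc m) + (of_nat (2 * t) * Z p m + H ((Q + 1) div 3)) +
        (of_nat (4 * t) * Z p m + H ((2 * Q + 1) div 3)) - (of_nat (3 * t) * Z p m + H (Q div 2))"
      using Zq by (simp only: G le)
    moreover have "(p + 1) div 2 = 3 * t + 1" using pt by simp
    ultimately show ?thesis by (simp add: Hm algebra_simps)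
  next
    assume pt: "p = 6 * t + 5"
    \<comment> \<open>Here the pieces of length about \<open>Q / 3\<close> and
      \<open>2 * Q / 3\<close> trade places, and the full periods number
      \<open>(2 * t + 1) + (4 * t + 3) - (3 * t + 2) = (p - 1) / 2\<close>.\<close>
    have qt: "q = 6 * X + 5 * Q" by (simp add: qQ pt X_def algebra_simps)
    have "(q + 1) div 3 = 2 * X + Q + (2 * Q + 1) div 3"
      "(2 * q + 1) div 3 = 4 * X + 3 * Q + (Q + 1) div 3" "q div 2 = 3 * X + 2 * Q + Q div 2"
      using div_mult_self4[of 3 "2 * X + Q" "2 * Q + 1"]
        div_mult_self4[of 3 "4 * X + 3 * Q" "Q + 1"] div_mult_self4[of 2 "3 * X + 2 * Q" Q]
      by (simp_all add: qt)
    then have "(q + 1) div 3 = (2 * t + 1) * Q + (2 * Q + 1) div 3"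
      "(2 * q + 1) div 3 = (4 * t + 3) * Q + (Q + 1) div 3"
      "q div 2 = (3 * t + 2) * Q + Q div 2"
      by (simp_all add: X_def algebra_simps)
    then have "Z p (Suc m) = E p (Suc m) + (of_nat (2 * t + 1) * Z p m + H ((2 * Q + 1) div 3)) +
        (of_nat (4 * t + 3) * Z p m + H ((Q + 1) div 3)) - (of_nat (3 * t + 2) * Z p m + H (Q div 2))"
      using Zq by (simp only: G le)
    moreover have "(p + 1) div 2 = 3 * t + 3" using pt by simp
    ultimately show ?thesis by (simp add: Hm algebra_simps)
  qed
qed

text \<open>Below \<open>p\<close> only the level \<open>j = 1\<close> can carry, so there are no
  zeros outside the two intervals.\<close>

lemma Z_1: "Z p 1 = E p 1"
proof -
  have "w n = 0" if "n < (p + 1) div 3 \<or> p div 2 \<le> n \<and> n < (2 * p + 1) div 3" for n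
  proof -
    have "n < p" using that ge_5 by auto
    moreover have "(p + 1) div 3 \<le> p div 2" using ge_5 by linarith
    ultimately have "n < p" "\<not> carry (p ^ 1) n"
      using that carry_top_iff[of n 1] by auto
    then have "\<not> zero_at p n" using zero_at_iff_carry_le[of n 1] by auto
    then show ?thesis by (simp add: run_weight_def run_start_def)
  qed
  then show ?thesis using Z_eq_E_add[of 1] by simp
qed

end

text \<open>Induction on \<open>m\<close> with \<open>h = (p + 1) / 2\<close>: the recursion
  multiplies the old sum by \<open>h\<close>, and \<open>h * E p m - E p m\<close> supplies the new
  term \<open>j = m\<close>, since \<open>h - 1 = (p - 1) / 2\<close>.\<close>

theorem theorem5p6:
  fixes p m :: nat
  assumes "prime p" and "p \<ge> 5" and "m \<ge> 1"
  shows "Z p m = E p m +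
    smult (int ((p - 1) div 2))
      (\<Sum>j = 1..m - 1. smult (int ((p + 1) div 2) ^ (m - j - 1)) (E p j))"
proof -
  interpret prime_ge_5 p using assms by unfold_locales auto
  define h where "h = int ((p + 1) div 2)"
  have h: "int ((p - 1) div 2) = h - 1" using p_odd by (auto simp: h_def elim!: oddE)
  show ?thesis unfolding h h_def[symmetric] using assms(3)
  proof (induction m rule: dec_induct)
    case base
    then show ?case using Z_1 by simp
  next
    case (step m)
    have "(\<Sum>j = 1..m. smult (h ^ (Suc m - j - 1)) (E p j)) =
        smult h (\<Sum>j = 1..m - 1. smult (h ^ (m - j - 1)) (E p j)) + E p m"
    proof -
      obtain k where k: "m = Suc k" using step.hyps by (cases m) auto
      have "(\<Sum>j = 1..k. smult (h ^ (Suc k - j)) (E p j)) =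
          (\<Sum>j = 1..k. smult h (smult (h ^ (k - j)) (E p j)))"
        by (intro sum.cong) (auto simp: Suc_diff_le)
      also have "\<dots> = smult h (\<Sum>j = 1..k. smult (h ^ (k - j)) (E p j))"
        by (simp only: smult_sum_right)
      finally show ?thesis by (simp add: k)
    qed
    moreover have "Z p (Suc m) = smult h (Z p m) + E p (Suc m) - E p m"
      using Z_Suc[OF step.hyps(1)] by (simp add: h_def of_nat_poly)
    ultimately show ?case
      by (simp add: step.IH smult_add_right smult_diff_left smult_diff_right algebra_simps)
  qed
qed

end
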